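(* Let $\mathbf{k}=(k_1,\ldots,k_n)$ be a tuple of positive integers ($n\geq 1$) and put $k=k_1+\cdots+k_n$. Define \[J(\mathbf{k})=\{0,\,k_1,\,k_1+k_2,\,\ldots,\,k_1+\cdots+k_{n-1}\},\] \[\Delta(\mathbf{k})=\Bigl\{(t_1,\ldots,t_k)\in[0,1]^k \Bigm| t_j<t_{j+1}\text{ if } j\notin J(\mathbf{k}),\ t_j>t_{j+1}\text{ if } j\in J(\mathbf{k}),\ \text{for } 1\le j\le k-1\Bigr\},\] and for $1\le j\le k$ let $\delta(j)=1$ if $j-1\in J(\mathbf{k})$ and $\delta(j)=0$ if $j-1\notin J(\mathbf{k})$. Then for every integer $N\geq 1$, \[s_{\mathbf{k}}(N)=\int_{\Delta(\mathbf{k})} t_1^{N-1}\,dt_1\,\omega_{\delta(2)}(t_2)\cdots\omega_{\delta(k)}(t_k),\] where $\omega_0(t)=\frac{dt}{t}$ and $\omega_1(t)=\frac{dt}{1-t}$.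
   Context: For a tuple $\mathbf{k}=(k_1,\ldots,k_n)$ of positive integers and a positive integer $N$, the finite multiple harmonic sum is \[s_{\mathbf{k}}(N)=\sum_{N=m_1\geq m_2\geq\cdots\geq m_n\geq 1}\frac{1}{m_1^{k_1}\cdots m_n^{k_n}}\] (note $m_1$ is fixed equal to $N$). *)

theory Defs
  imports "HOL-Analysis.Analysis"
begin

text \<open>An index tuple \<open>(k\<^sub>1, \<dots>, k\<^sub>n)\<close> is a list \<open>ks\<close>, so \<open>k\<^sub>i\<close> is \<open>ks ! (i - 1)\<close>;
  its weight \<open>k\<^sub>1 + \<dots> + k\<^sub>n\<close> is \<open>sum_list ks\<close>.\<close>

definition mhs :: "nat list \<Rightarrow> nat \<Rightarrow> real" where
  "mhs ks N =
     (\<Sum>ms | length ms = length ks \<and> ms ! 0 = N \<and>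
            (\<forall>i. Suc i < length ks \<longrightarrow> ms ! i \<ge> ms ! Suc i) \<and>
            (\<forall>i < length ks. ms ! i \<ge> 1).
        1 / (\<Prod>i<length ks. real (ms ! i) ^ (ks ! i)))"

definition J :: "nat list \<Rightarrow> nat set" where
  "J ks = {sum_list (take i ks) | i. i < length ks}"

text \<open>Points of \<open>[0,1]\<^sup>k\<close> are functions on \<open>{1..k}\<close>, extensional so that they lie in the
  space of the product measure used for integration.\<close>

definition Delta :: "nat list \<Rightarrow> (nat \<Rightarrow> real) set" where
  "Delta ks = {t \<in> {1..sum_list ks} \<rightarrow>\<^sub>E {0..1}.
     \<forall>j. 1 \<le> j \<and> j \<le> sum_list ks - 1 \<longrightarrow>
       (j \<notin> J ks \<longrightarrow> t j < t (j + 1)) \<and> (j \<in> J ks \<longrightarrow> t j > t (j + 1))}"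

definition delta :: "nat list \<Rightarrow> nat \<Rightarrow> nat" where
  "delta ks j = (if j - 1 \<in> J ks then 1 else 0)"

text \<open>Densities of the forms \<open>\<omega>\<^sub>0 = dt / t\<close> and \<open>\<omega>\<^sub>1 = dt / (1 - t)\<close>; only the indices 0 and 1
  occur.\<close>

definition omega :: "nat \<Rightarrow> real \<Rightarrow> real" where
  "omega d t = (if d = 0 then 1 / t else 1 / (1 - t))"

end

theory Submission
  imports Defs
begin

text \<open>Integrate out \<open>t\<^sub>1\<close> first. Since \<open>\<integral>\<^sub>0\<^sup>y t\<^bsup>N-1\<^esup> dt / y = y\<^bsup>N-1\<^esup> / N\<close> and
  \<open>\<integral>\<^sub>y\<^sup>1 t\<^bsup>N-1\<^esup> dt / (1 - y) = (1 + y + \<dots> + y\<^bsup>N-1\<^esup>) / N\<close>, the integral for \<open>N\<close> over \<open>k\<close> variables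
  is \<open>1 / N\<close> times the integral for \<open>N\<close>, respectively the sum of the integrals for \<open>1, \<dots>, N\<close>, over
  the remaining \<open>k - 1\<close> variables. The harmonic sums satisfy the same recursion.\<close>

section \<open>Recursion for the harmonic sums\<close>

definition mhs_indices :: "nat list \<Rightarrow> nat \<Rightarrow> nat list set" where
  "mhs_indices ks N = {ms. length ms = length ks \<and> ms ! 0 = N \<and>
     (\<forall>i. Suc i < length ks \<longrightarrow> ms ! i \<ge> ms ! Suc i) \<and> (\<forall>i < length ks. ms ! i \<ge> 1)}"

lemma mhs_indices_singleton:
  assumes "N \<ge> 1"
  shows "mhs_indices [k] N = {[N]}"
  using assms by (auto simp: mhs_indices_def length_Suc_conv)

text \<open>Deleting the leading \<open>N\<close> leaves a decreasing list of positive entries whose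
  own head \<open>m\<close> can be any number from 1 to \<open>N\<close>; fixing \<open>m\<close>
  sorts these tails into the sets \<open>mhs_indices ks m\<close>.\<close>

lemma mhs_indices_Cons:
  assumes "ks \<noteq> []" "N \<ge> 1"
  shows "mhs_indices (k # ks) N = (#) N ` (\<Union>m\<in>{1..N}. mhs_indices ks m)"
proof (intro equalityI subsetI)
  fix ms assume ms: "ms \<in> mhs_indices (k # ks) N"
  then obtain ms' where [simp]: "ms = N # ms'"
    by (cases ms) (auto simp: mhs_indices_def)
  from ms have len: "length ms' = length ks"
    and dec: "\<And>i. i < length ks \<Longrightarrow> (N # ms') ! i \<ge> (N # ms') ! Suc i"
    and ge: "\<And>i. i < Suc (length ks) \<Longrightarrow> (N # ms') ! i \<ge> 1"
    by (auto simp: mhs_indices_def)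
  have "ms' \<in> mhs_indices ks (ms' ! 0)"
    using len dec[of "Suc i" for i] ge[of "Suc i" for i] by (auto simp: mhs_indices_def)
  moreover have "ms' ! 0 \<in> {1..N}"
    using assms dec[of 0] ge[of 1] by auto
  ultimately have "ms' \<in> (\<Union>m\<in>{1..N}. mhs_indices ks m)"
    by blast
  then show "ms \<in> (#) N ` (\<Union>m\<in>{1..N}. mhs_indices ks m)"
    by simp
next
  fix ms assume "ms \<in> (#) N ` (\<Union>m\<in>{1..N}. mhs_indices ks m)"
  then show "ms \<in> mhs_indices (k # ks) N"
    using assms by (auto simp: mhs_indices_def nth_Cons split: nat.splits)
qed

lemma finite_mhs_indices:
  assumes "ks \<noteq> []" "N \<ge> 1"
  shows "finite (mhs_indices ks N)"
  using assms
proof (induction ks arbitrary: N)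
  case (Cons k ks)
  then show ?case
    by (cases "ks = []") (auto simp: mhs_indices_singleton mhs_indices_Cons)
qed simp

lemma mhs_eq_sum_indices:
  "mhs ks N = (\<Sum>ms\<in>mhs_indices ks N. 1 / (\<Prod>i<length ks. real (ms ! i) ^ (ks ! i)))"
  by (simp add: mhs_def mhs_indices_def)

lemma mhs_nonneg: "0 \<le> mhs ks N"
  by (auto simp: mhs_eq_sum_indices intro!: sum_nonneg prod_nonneg)

lemma mhs_singleton:
  assumes "N \<ge> 1"
  shows "mhs [k] N = 1 / real N ^ k"
  using assms by (simp add: mhs_eq_sum_indices mhs_indices_singleton)

lemma mhs_Cons:
  assumes "ks \<noteq> []" "N \<ge> 1"
  shows "mhs (k # ks) N = 1 / real N ^ k * (\<Sum>m=1..N. mhs ks m)"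
proof -
  let ?w = "\<lambda>ks ms. 1 / (\<Prod>i<length ks. real (ms ! i) ^ (ks ! i))"
  have "mhs (k # ks) N = (\<Sum>ms\<in>(\<Union>m\<in>{1..N}. mhs_indices ks m). ?w (k # ks) (N # ms))"
    using assms by (simp add: mhs_eq_sum_indices mhs_indices_Cons sum.reindex del: prod.lessThan_Suc)
  also have "\<dots> = (\<Sum>ms\<in>(\<Union>m\<in>{1..N}. mhs_indices ks m). 1 / real N ^ k * ?w ks ms)"
    by (intro sum.cong refl) (simp add: prod.lessThan_Suc_shift del: prod.lessThan_Suc)
  also have "\<dots> = 1 / real N ^ k * (\<Sum>ms\<in>(\<Union>m\<in>{1..N}. mhs_indices ks m). ?w ks ms)"
    by (simp only: sum_distrib_left)
  also have "(\<Sum>ms\<in>(\<Union>m\<in>{1..N}. mhs_indices ks m). ?w ks ms) = (\<Sum>m=1..N. mhs ks m)"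
    unfolding mhs_eq_sum_indices
    \<comment> \<open>The index sets are disjoint for distinct \<open>m\<close>, since
      \<open>m\<close> is the first entry of every list in \<open>mhs_indices ks m\<close>.\<close>
    by (rule sum.UNION_disjoint) (use assms in \<open>auto simp: finite_mhs_indices\<close>, auto simp: mhs_indices_def)
  finally show ?thesis .
qed

text \<open>The empty partial sum gives 0, and every longer one contains \<open>k\<close>, so a new
  first block shifts the old break points by \<open>k\<close>.\<close>

lemma J_Cons:
  "J (k # ks) = insert 0 ((+) k ` J ks)"
proof -
  have "J (k # ks) = (\<lambda>i. sum_list (take i (k # ks))) ` {..<Suc (length ks)}"
    by (auto simp: J_def)
  also have "\<dots> = insert 0 ((+) k ` J ks)"
    by (auto simp: lessThan_Suc_eq_insert_0 image_image J_def)
  finally show ?thesis .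
qed

section \<open>Integrating out the first variable\<close>

interpretation lborel_prod: product_sigma_finite "\<lambda>_::nat. lborel :: real measure"
  by standard

text \<open>Membership of \<open>j\<close> in \<open>J ks\<close> decides both the direction of the
  inequality between \<open>t j\<close> and \<open>t (j + 1)\<close> and the density at
  \<open>t (j + 1)\<close>, so one factor with \<open>x = t j\<close>, \<open>y = t (j + 1)\<close>
  carries both.\<close>

definition step :: "bool \<Rightarrow> real \<Rightarrow> real \<Rightarrow> real" where
  "step e x y = (if e then of_bool (y < x) / (1 - y) else of_bool (x < y) / y)"

text \<open>\<open>E\<close> is the set of descents, and \<open>a\<close> the first of the remaining variables. The cube is taken
  open to avoid the junk values \<open>1 / 0 = 0\<close> of the densities.\<close>

definition chain :: "nat set \<Rightarrow> nat \<Rightarrow> nat \<Rightarrow> (nat \<Rightarrow> real) \<Rightarrow> real" where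
  "chain E K a t = (\<Prod>j=a..K. indicator {0<..<1} (t j)) * (\<Prod>j=a..<K. step (j \<in> E) (t j) (t (Suc j)))"

text \<open>With values in \<open>ennreal\<close>, Tonelli applies without any integrability
  argument. \<open>E\<close> and \<open>K\<close> stay fixed while \<open>a\<close> grows, so no
  variable is ever renumbered.\<close>

definition chain_int :: "nat set \<Rightarrow> nat \<Rightarrow> nat \<Rightarrow> nat \<Rightarrow> ennreal" where
  "chain_int E K a N =
     (\<integral>\<^sup>+ t. ennreal (t a ^ (N - 1) * chain E K a t) \<partial>(\<Pi>\<^sub>M j\<in>{a..K}. (lborel :: real measure)))"

text \<open>Outside the cube a \<open>step\<close> factor can be negative, such as
  \<open>1 / (1 - y)\<close> for \<open>y > 1\<close>, but there the product of indicators is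
  0.\<close>

lemma chain_nonneg: "0 \<le> chain E K a t"
proof (cases "\<exists>j\<in>{a..K}. t j \<notin> {0<..<1}")
  case True
  then have "(\<Prod>j=a..K. indicator {0<..<1} (t j) :: real) = 0"
    by (intro prod_zero) (auto simp: indicator_def)
  then show ?thesis by (simp only: chain_def mult_zero_left order.refl)
next
  case False
  then have "0 < t j" "t j < 1" if "a \<le> j" "j \<le> K" for j
    using that by auto
  then have "0 \<le> step (j \<in> E) (t j) (t (Suc j))" if "j \<in> {a..<K}" for j
    using that by (simp add: step_def less_imp_le)
  then show ?thesis
    unfolding chain_def by (intro mult_nonneg_nonneg prod_nonneg) auto
qed

lemma chain_eq_Suc:
  assumes "a < K"
  shows "chain E K a t = indicator {0<..<1} (t a) * step (a \<in> E) (t a) (t (Suc a)) * chain E K (Suc a) t"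
  using assms by (simp add: chain_def prod.atLeast_Suc_atMost prod.atLeast_Suc_lessThan)

lemma chain_update:
  assumes "b < a"
  shows "chain E K a (t(b := y)) = chain E K a t"
  using assms by (auto simp: chain_def intro!: arg_cong2[where f = "(*)"] prod.cong)

text \<open>The indicator is idempotent, so a second copy may be split off; this shows that
  \<open>chain\<close> vanishes as soon as its first variable leaves (0,1).\<close>

lemma chain_eq_indicator_mult:
  assumes "a \<le> K"
  shows "chain E K a t = indicator {0<..<1} (t a) * chain E K a t"
  using assms by (auto simp: chain_def prod.atLeast_Suc_atMost indicator_def)

lemma measurable_step [measurable]:
  assumes [measurable]: "f \<in> borel_measurable M" "g \<in> borel_measurable M"
  shows "(\<lambda>x. step e (f x) (g x)) \<in> borel_measurable M"
  unfolding step_def of_bool_def by measurable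

lemma measurable_chain:
  assumes "{a..K} \<subseteq> I"
  shows "chain E K a \<in> borel_measurable (\<Pi>\<^sub>M j\<in>I. (lborel :: real measure))"
proof -
  have comp [measurable]: "(\<lambda>t. t j) \<in> borel_measurable (\<Pi>\<^sub>M j\<in>I. (lborel :: real measure))" if "j \<in> {a..K}" for j
    using measurable_component_singleton[of j I "\<lambda>_. lborel :: real measure"] assms that by auto
  show ?thesis
    unfolding chain_def
    by (intro borel_measurable_times borel_measurable_prod measurable_step
        measurable_compose[OF _ borel_measurable_indicator[of "{0<..<1::real}" borel]] comp) auto
qed

lemma measurable_chain_integrand:
  assumes "a \<le> K" "{a..K} \<subseteq> I"
  shows "(\<lambda>t. t a ^ n * chain E K a t) \<in> borel_measurable (\<Pi>\<^sub>M j\<in>I. (lborel :: real measure))"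
proof -
  have [measurable]: "a \<in> I" using assms by auto
  note [measurable] = measurable_chain[OF assms(2)]
  show ?thesis by measurable
qed

section \<open>Elementary integrals in one variable\<close>

lemma nn_integral_power_Ioo:
  fixes a b :: real
  assumes "0 \<le> a" "a \<le> b" "N \<ge> 1"
  shows "(\<integral>\<^sup>+ x. ennreal (x ^ (N - 1)) * indicator {a<..<b} x \<partial>lborel) = ennreal ((b ^ N - a ^ N) / N)"
proof (rule nn_integral_has_integral_lebesgue')
  have "((\<lambda>x. x ^ (N - 1)) has_integral b ^ N / N - a ^ N / N) {a..b}"
    using assms
    by (intro fundamental_theorem_of_calculus)
       (auto intro!: derivative_eq_intros simp flip: has_real_derivative_iff_has_vector_derivative)
  then show "((\<lambda>x. x ^ (N - 1)) has_integral (b ^ N - a ^ N) / N) {a<..<b}"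
    by (simp add: has_integral_Icc_iff_Ioo diff_divide_distrib)
qed (use assms in auto)

text \<open>A descent produces a finite geometric sum, an ascent only its top term
  \<open>m = N\<close>. Writing both as a sum over an index set lets the recursion treat them
  together.\<close>

lemma nn_integral_step:
  fixes y :: real
  assumes y: "0 < y" "y < 1" and N: "N \<ge> 1"
  shows "(\<integral>\<^sup>+ x. ennreal (x ^ (N - 1) * (indicator {0<..<1} x * step e x y)) \<partial>lborel)
    = ennreal (1 / N * (\<Sum>m\<in>(if e then {1..N} else {N}). y ^ (m - 1)))"
proof -
  \<comment> \<open>The density is evaluated at \<open>y\<close>, hence is the constant
    \<open>c\<close> in \<open>x\<close>; the inequality in \<open>step\<close> cuts (0,1) down to
    \<open>A\<close>.\<close>
  define A where "A = (if e then {y<..<1} else {0<..<y})"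
  define c where "c = 1 / (if e then 1 - y else y)"
  have "ennreal (x ^ (N - 1) * (indicator {0<..<1} x * step e x y))
      = ennreal c * (ennreal (x ^ (N - 1)) * indicator A x)" for x
    using y by (auto simp: A_def c_def step_def indicator_def simp flip: ennreal_mult)
  then have "(\<integral>\<^sup>+ x. ennreal (x ^ (N - 1) * (indicator {0<..<1} x * step e x y)) \<partial>lborel)
      = ennreal c * (\<integral>\<^sup>+ x. ennreal (x ^ (N - 1)) * indicator A x \<partial>lborel)"
    by (simp add: A_def nn_integral_cmult)
  also have "(\<integral>\<^sup>+ x. ennreal (x ^ (N - 1)) * indicator A x \<partial>lborel)
      = ennreal ((if e then 1 - y ^ N else y ^ N) / N)"
    using nn_integral_power_Ioo[of y 1 N] nn_integral_power_Ioo[of 0 y N] assms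
    by (auto simp: A_def zero_power)
  also have "ennreal c * \<dots> = ennreal (c * ((if e then 1 - y ^ N else y ^ N) / N))"
    using y by (intro ennreal_mult[symmetric]) (auto simp: c_def power_le_one)
  also have "c * ((if e then 1 - y ^ N else y ^ N) / N)
      = 1 / N * (\<Sum>m\<in>(if e then {1..N} else {N}). y ^ (m - 1))"
  proof (cases e)
    case True
    have "(\<Sum>m=1..N. y ^ (m - 1)) = (\<Sum>m<N. y ^ m)"
      by (rule sum.reindex_bij_witness[of _ Suc "\<lambda>m. m - 1"]) auto
    then have "1 - y ^ N = (1 - y) * (\<Sum>m=1..N. y ^ (m - 1))"
      by (simp add: one_diff_power_eq)
    then show ?thesis
      using True y by (simp add: c_def)
  next
    case False
    then show ?thesis
      using y N by (simp add: c_def power_diff)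
  qed
  finally show ?thesis .
qed

section \<open>The recursion for the chain integrals\<close>

lemma chain_int_last:
  assumes "N \<ge> 1"
  shows "chain_int E K K N = ennreal (1 / N)"
proof -
  have "chain_int E K K N = (\<integral>\<^sup>+ t. ennreal (t K ^ (N - 1) * indicator {0<..<1} (t K)) \<partial>(\<Pi>\<^sub>M j\<in>{K}. lborel))"
    by (simp add: chain_int_def chain_def)
  also have "\<dots> = (\<integral>\<^sup>+ x. ennreal (x ^ (N - 1) * indicator {0<..<1} x) \<partial>lborel)"
    by (rule lborel_prod.product_nn_integral_singleton) measurable
  also have "\<dots> = (\<integral>\<^sup>+ x. ennreal (x ^ (N - 1)) * indicator {0<..<1} x \<partial>lborel)"
    by (intro nn_integral_cong) (auto simp: indicator_def)
  also have "\<dots> = ennreal (1 / N)"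
    using nn_integral_power_Ioo[of 0 1 N] assms by (simp add: zero_power)
  finally show ?thesis .
qed

text \<open>By Tonelli \<open>t a\<close> is integrated innermost. It occurs only in the power, its
  indicator and the first \<open>step\<close>, so \<open>nn_integral_step\<close> turns the
  integrand into powers of the next variable, each again of the form in
  \<open>chain_int\<close>.\<close>

lemma chain_int_Suc:
  assumes "a < K" "N \<ge> 1"
  shows "chain_int E K a N =
    ennreal (1 / N) * (\<Sum>m\<in>(if a \<in> E then {1..N} else {N}). chain_int E K (Suc a) m)"
proof -
  let ?S = "if a \<in> E then {1..N} else {N}"
  let ?M = "\<Pi>\<^sub>M j\<in>{Suc a..K}. (lborel :: real measure)"
  note [measurable] = measurable_chain_integrand[of "Suc a" K "{Suc a..K}", simplified]
  have ins: "{a..K} = insert a {Suc a..K}"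
    using assms by auto
  have "chain_int E K a N = (\<integral>\<^sup>+ t. \<integral>\<^sup>+ x. ennreal ((t(a := x)) a ^ (N - 1) * chain E K a (t(a := x))) \<partial>lborel \<partial>?M)"
    unfolding chain_int_def ins
    using assms
    by (intro lborel_prod.product_nn_integral_insert measurable_compose[OF measurable_chain_integrand]) auto
  also have "\<dots> = (\<integral>\<^sup>+ t. ennreal (1 / N) * (\<Sum>m\<in>?S. ennreal (t (Suc a) ^ (m - 1) * chain E K (Suc a) t)) \<partial>?M)"
  proof (intro nn_integral_cong)
    fix t :: "nat \<Rightarrow> real"
    let ?y = "t (Suc a)"
    let ?c = "chain E K (Suc a) t"
    have "(\<integral>\<^sup>+ x. ennreal ((t(a := x)) a ^ (N - 1) * chain E K a (t(a := x))) \<partial>lborel)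
        = (\<integral>\<^sup>+ x. ennreal (?c * (x ^ (N - 1) * (indicator {0<..<1} x * step (a \<in> E) x ?y))) \<partial>lborel)"
      using assms by (intro nn_integral_cong) (simp add: chain_eq_Suc chain_update mult_ac)
    also have "\<dots> = ennreal ?c * (\<integral>\<^sup>+ x. ennreal (x ^ (N - 1) * (indicator {0<..<1} x * step (a \<in> E) x ?y)) \<partial>lborel)"
      by (simp add: ennreal_mult' chain_nonneg nn_integral_cmult)
    also have "\<dots> = ennreal (1 / N) * (\<Sum>m\<in>?S. ennreal (?y ^ (m - 1) * ?c))"
    \<comment> \<open>The one-variable formula needs \<open>?y\<close> inside (0,1); elsewhere
      \<open>?c\<close> is 0 and both sides vanish.\<close>
    proof (cases "0 < ?y \<and> ?y < 1")
      case True
      have "(\<Sum>m\<in>?S. ennreal (?y ^ (m - 1) * ?c)) = ennreal (\<Sum>m\<in>?S. ?y ^ (m - 1) * ?c)"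
        using True by (intro sum_ennreal) (simp add: chain_nonneg)
      then show ?thesis
        using True nn_integral_step[of ?y N "a \<in> E"] assms
        by (simp add: chain_nonneg sum_nonneg sum_distrib_left mult_ac flip: ennreal_mult' ennreal_mult'')
    next
      case False
      then have "?c = 0"
        using chain_eq_indicator_mult[of "Suc a" K E t] assms by (auto simp: indicator_def)
      then show ?thesis by simp
    qed
    finally show "(\<integral>\<^sup>+ x. ennreal ((t(a := x)) a ^ (N - 1) * chain E K a (t(a := x))) \<partial>lborel)
        = ennreal (1 / N) * (\<Sum>m\<in>?S. ennreal (?y ^ (m - 1) * ?c))" .
  qed
  also have "\<dots> = ennreal (1 / N) * (\<Sum>m\<in>?S. chain_int E K (Suc a) m)"
    unfolding chain_int_def using assms
    by (subst nn_integral_cmult nn_integral_sum; measurable)+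
  finally show ?thesis .
qed

section \<open>Matching the two recursions block by block\<close>

lemma chain_int_ascents:
  assumes "a + d \<le> K" "N \<ge> 1" "\<And>j. a \<le> j \<Longrightarrow> j < a + d \<Longrightarrow> j \<notin> E"
  shows "chain_int E K a N = ennreal (1 / real N ^ d) * chain_int E K (a + d) N"
  using assms
proof (induction d)
  case (Suc d)
  then have "chain_int E K a N = ennreal (1 / real N ^ d) * chain_int E K (a + d) N"
    by simp
  also have "chain_int E K (a + d) N = ennreal (1 / N) * chain_int E K (Suc (a + d)) N"
    using Suc.prems by (subst chain_int_Suc) auto
  finally show ?case
    by (simp add: mult.assoc[symmetric] mult.commute flip: ennreal_mult')
qed simp

text \<open>Here \<open>s\<close> variables are already integrated out: \<open>E\<close> uses
  absolute positions, \<open>J ks\<close> counts from the current block. A block of length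
  \<open>k\<close> has \<open>k - 1\<close> ascents, each giving \<open>1 / N\<close>; its last
  variable gives one more \<open>1 / N\<close> and, unless it is the final variable, a descent that
  sums over \<open>m\<close>, as in \<open>mhs_Cons\<close>.\<close>

lemma chain_int_eq_mhs:
  assumes "ks \<noteq> []" "\<forall>x\<in>set ks. x \<ge> 1" "N \<ge> 1" "K = s + sum_list ks"
    and "\<And>j. s < j \<Longrightarrow> j < K \<Longrightarrow> j \<in> E \<longleftrightarrow> j - s \<in> J ks"
  shows "chain_int E K (Suc s) N = ennreal (mhs ks N)"
  using assms
proof (induction ks arbitrary: s N)
  case (Cons k ks)
  define d where "d = k - 1"
  have k: "k = Suc d"
    using Cons.prems by (simp add: d_def)
  \<comment> \<open>Inside the block \<open>j - s\<close> lies strictly between 0 and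
    \<open>k\<close>, where \<open>J (k # ks)\<close> has no element.\<close>
  have no_desc: "j \<notin> E" if "Suc s \<le> j" "j < Suc s + d" for j
    using that Cons.prems(4) Cons.prems(5)[of j] by (auto simp: k J_Cons)
  have asc: "chain_int E K (Suc s) N = ennreal (1 / real N ^ d) * chain_int E K (s + k) N"
    using Cons.prems(3,4) chain_int_ascents[of "Suc s" d K N E, OF _ _ no_desc]
    by (simp add: k)
  show ?case
  proof (cases "ks = []")
    case True
    then show ?thesis
      using asc Cons.prems(3,4)
      by (simp add: chain_int_last mhs_singleton k mult.commute flip: ennreal_mult')
  next
    case False
    then obtain k' ks' where ks: "ks = k' # ks'"
      by (cases ks) auto
    have pos: "sum_list ks > 0"
      using Cons.prems(2) by (simp add: ks)
    have "0 \<in> J ks"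
      by (simp add: ks J_Cons)
    then have desc: "s + k \<in> E"
      using Cons.prems(4) Cons.prems(5)[of "s + k"] pos by (auto simp: k J_Cons)
    have IH: "chain_int E K (Suc (s + k)) m = ennreal (mhs ks m)" if "m \<in> {1..N}" for m
    proof (rule Cons.IH)
      show "j \<in> E \<longleftrightarrow> j - (s + k) \<in> J ks" if "s + k < j" "j < K" for j
      proof -
        \<comment> \<open>This form removes truncated subtraction: \<open>j - s\<close> is
          \<open>k + i\<close> and \<open>j - (s + k)\<close> is \<open>i\<close>.\<close>
        obtain i where "j = s + (k + i)"
          using less_imp_add_positive[OF \<open>s + k < j\<close>] by (auto simp: add.assoc)
        then show ?thesis
          using that Cons.prems(5)[of j] by (auto simp: J_Cons)
      qed
    qed (use False Cons.prems that in auto)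
    have "chain_int E K (s + k) N = ennreal (1 / N) * (\<Sum>m=1..N. ennreal (mhs ks m))"
      using desc Cons.prems(3,4) pos IH by (subst chain_int_Suc) auto
    also have "\<dots> = ennreal (1 / N * (\<Sum>m=1..N. mhs ks m))"
      by (simp add: mhs_nonneg sum_nonneg flip: ennreal_mult')
    finally show ?thesis
      using asc False Cons.prems(3)
      by (simp add: mhs_Cons k mult.assoc mhs_nonneg sum_nonneg flip: ennreal_mult')
  qed
qed simp

section \<open>Passing to the closed cube\<close>

text \<open>The hyperplane is a box with one side \<open>{c}\<close> of measure 0; the other sides
  have infinite measure, but a product in \<open>ennreal\<close> with a factor 0 is 0.\<close>

lemma AE_lborel_prod_neq:
  fixes j :: nat
  assumes "finite I" "j \<in> I"
  shows "AE t in (\<Pi>\<^sub>M j\<in>I. (lborel :: real measure)). t j \<noteq> c"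
proof (rule AE_I')
  let ?A = "\<lambda>i::nat. if i = j then {c} else UNIV"
  have "emeasure (\<Pi>\<^sub>M j\<in>I. (lborel :: real measure)) (Pi\<^sub>E I ?A) = (\<Prod>i\<in>I. emeasure lborel (?A i))"
    using assms by (intro lborel_prod.emeasure_PiM) auto
  also have "\<dots> = 0"
    using assms by (intro prod_zero bexI[of _ j]) auto
  finally show "Pi\<^sub>E I ?A \<in> null_sets (\<Pi>\<^sub>M j\<in>I. (lborel :: real measure))"
    using assms by (auto intro!: null_setsI sets_PiM_I_finite)
  show "{t \<in> space (\<Pi>\<^sub>M j\<in>I. (lborel :: real measure)). \<not> t j \<noteq> c} \<subseteq> Pi\<^sub>E I ?A"
    by (auto simp: space_PiM PiE_iff extensional_def)
qed

text \<open>Off the faces of the cube, closed and open cube agree. On \<open>Delta ks\<close> every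
  \<open>of_bool\<close> is 1 and \<open>step\<close> reduces to the density; off it, some indicator
  or \<open>step\<close> is 0.\<close>

lemma Delta_integrand_eq_chain:
  assumes "t \<in> extensional {1..sum_list ks}" "\<And>j. j \<in> {1..sum_list ks} \<Longrightarrow> t j \<noteq> 0 \<and> t j \<noteq> 1"
  shows "indicator (Delta ks) t * (\<Prod>j=2..sum_list ks. omega (delta ks j) (t j))
    = chain (J ks) (sum_list ks) 1 t"
proof -
  let ?K = "sum_list ks"
  \<comment> \<open>Each density is reindexed by the pair of neighbours ending at its variable, as
    in \<open>chain\<close>.\<close>
  have shift: "(\<Prod>j=2..?K. omega (delta ks j) (t j)) = (\<Prod>j=1..<?K. omega (delta ks (Suc j)) (t (Suc j)))"
    by (rule prod.reindex_bij_witness[of _ Suc "\<lambda>j. j - 1"]) auto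
  show ?thesis
  proof (cases "t \<in> Delta ks")
    case True
    then have "(\<Prod>j=1..?K. indicator {0<..<1} (t j) :: real) = 1"
      using assms(2) by (intro prod.neutral) (force simp: Delta_def PiE_iff indicator_def less_le)
    moreover have "(\<Prod>j=1..<?K. omega (delta ks (Suc j)) (t (Suc j))) = (\<Prod>j=1..<?K. step (j \<in> J ks) (t j) (t (Suc j)))"
      using True by (intro prod.cong) (auto simp: Delta_def omega_def delta_def step_def)
    ultimately show ?thesis
      using True by (simp add: chain_def shift)
  next
    case False
    then consider j where "j \<in> {1..?K}" "t j \<notin> {0..1}"
      | j where "j \<in> {1..<?K}" "step (j \<in> J ks) (t j) (t (Suc j)) = 0"
      using assms(1) by (fastforce simp: Delta_def PiE_iff step_def)
    then have "chain (J ks) ?K 1 t = 0"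
    proof cases
      case 1
      then show ?thesis
        by (auto simp: chain_def intro!: prod_zero bexI[of _ j])
    next
      case 2
      then show ?thesis
        by (auto simp: chain_def intro!: prod_zero bexI[of _ j])
    qed
    then show ?thesis
      using False by simp
  qed
qed

lemma sets_Delta [measurable]:
  "Delta ks \<in> sets (\<Pi>\<^sub>M j\<in>{1..sum_list ks}. (lborel :: real measure))"
proof -
  let ?K = "sum_list ks"
  let ?M = "\<Pi>\<^sub>M j\<in>{1..?K}. (lborel :: real measure)"
  have comp [measurable]: "(\<lambda>t. t j) \<in> borel_measurable ?M" if "j \<in> {1..?K}" for j
    using measurable_component_singleton[of j "{1..?K}" "\<lambda>_. lborel :: real measure"] that by auto
  have "Delta ks = {t \<in> space ?M. (\<forall>j\<in>{1..?K}. t j \<in> {0..1}) \<and>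
      (\<forall>j\<in>{1..<?K}. if j \<in> J ks then t (Suc j) < t j else t j < t (Suc j))}"
    by (fastforce simp: Delta_def space_PiM PiE_iff split: if_splits)
  also have "\<dots> \<in> sets ?M"
  proof (intro sets.sets_Collect_conj sets.sets_Collect_finite_All)
    fix j assume "j \<in> {1..?K}"
    note [measurable] = comp[OF this]
    show "{t \<in> space ?M. t j \<in> {0..1}} \<in> sets ?M"
      by measurable
  next
    fix j assume j: "j \<in> {1..<?K}"
    have [measurable]: "(\<lambda>t. t j) \<in> borel_measurable ?M" "(\<lambda>t. t (Suc j)) \<in> borel_measurable ?M"
      using j by (intro comp; simp)+
    show "{t \<in> space ?M. if j \<in> J ks then t (Suc j) < t j else t j < t (Suc j)} \<in> sets ?M"
      by measurable
  qed auto
  finally show ?thesis .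
qed

theorem theorem1p2:
  fixes ks :: "nat list" and N :: nat
  assumes "ks \<noteq> []" and "\<forall>x \<in> set ks. x \<ge> 1" and "N \<ge> 1"
  shows "mhs ks N =
    (LINT t : Delta ks | (\<Pi>\<^sub>M j \<in> {1..sum_list ks}. (lborel :: real measure)).
       t 1 ^ (N - 1) * (\<Prod>j = 2..sum_list ks. omega (delta ks j) (t j)))"
proof -
  let ?K = "sum_list ks"
  let ?M = "\<Pi>\<^sub>M j \<in> {1..?K}. (lborel :: real measure)"
  let ?f = "\<lambda>t. t 1 ^ (N - 1) * (\<Prod>j=2..?K. omega (delta ks j) (t j))"
  let ?g = "\<lambda>t. t 1 ^ (N - 1) * chain (J ks) ?K 1 t"
  have K: "1 \<le> ?K"
    using assms(1,2) by (cases ks) auto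
  have comp [measurable]: "(\<lambda>t. t j) \<in> borel_measurable ?M" if "j \<in> {1..?K}" for j
    using measurable_component_singleton[of j "{1..?K}" "\<lambda>_. lborel :: real measure"] that by auto
  have g: "?g \<in> borel_measurable ?M"
    using K by (intro measurable_chain_integrand) auto
  have [measurable]: "omega d \<in> borel_measurable borel" for d
    unfolding omega_def by measurable
  have f: "?f \<in> borel_measurable ?M"
    using K by (intro borel_measurable_times borel_measurable_power borel_measurable_prod
        measurable_compose[OF comp]) auto
  have "AE t in ?M. \<forall>j\<in>{1..?K}. t j \<noteq> 0 \<and> t j \<noteq> 1"
    by (intro AE_finite_allI AE_conjI AE_lborel_prod_neq) auto
  then have "AE t in ?M. indicator (Delta ks) t *\<^sub>R ?f t = ?g t"
  proof (rule AE_mp, intro AE_I2 impI)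
    fix t assume "t \<in> space ?M" "\<forall>j\<in>{1..?K}. t j \<noteq> 0 \<and> t j \<noteq> 1"
    then have "indicator (Delta ks) t * (\<Prod>j=2..?K. omega (delta ks j) (t j)) = chain (J ks) ?K 1 t"
      by (intro Delta_integrand_eq_chain) (auto simp: space_PiM PiE_iff)
    then show "indicator (Delta ks) t *\<^sub>R ?f t = ?g t"
      by (metis mult.left_commute real_scaleR_def)
  qed
  then have "(LINT t : Delta ks | ?M. ?f t) = (LINT t | ?M. ?g t)"
    unfolding set_lebesgue_integral_def using f g
    by (intro integral_cong_AE borel_measurable_scaleR borel_measurable_indicator sets_Delta)
  \<comment> \<open>For a nonnegative measurable integrand this holds without integrability; the
    value found below is finite, so \<open>enn2real\<close> loses nothing.\<close>
  also have "\<dots> = enn2real (chain_int (J ks) ?K 1 N)"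
  proof -
    \<comment> \<open>The power may be negative for \<open>t 1 < 0\<close>, but there
      \<open>chain\<close> is 0.\<close>
    have "0 \<le> ?g t" for t
      using K chain_nonneg[of "J ks" ?K 1 t] chain_eq_indicator_mult[of 1 ?K "J ks" t]
      by (cases "0 < t 1") auto
    then show ?thesis
      using g by (simp add: chain_int_def integral_eq_nn_integral)
  qed
  also have "chain_int (J ks) ?K 1 N = ennreal (mhs ks N)"
    using chain_int_eq_mhs[of ks N ?K 0 "J ks"] assms by simp
  finally show ?thesis
    by (simp add: mhs_nonneg)
qed

end
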